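(* Let $p,q,\upsilon,\sigma,\tau,w_1,w_2,\gamma_1,\gamma_2,\gamma_3,\mu_1,\mu_2,\mu_3\in\mathbb{C}$ with $\operatorname{Re}(p)>0$, $\operatorname{Re}(q)>0$, $\operatorname{Re}(\upsilon)>0$, $\operatorname{Re}(\sigma)>0$, $\operatorname{Re}(\tau)>0$. Then, for $z,t>0$, $$\int_{0}^{t}\int_{0}^{z}(z-\xi)^{p-1}(t-y)^{q-1}E_{\frac{\gamma_{1}+1}{2},\gamma_{2},\gamma_{3};p;q;\upsilon}^{(\gamma_{1};\gamma_{2};\gamma_{3})}(w_{1}(z-\xi),w_{2}(t-y))\;\xi^{\sigma-1}y^{\tau-1}E_{\frac{\mu_{1}+1}{2},\mu_{2},\mu_{3};\sigma;\tau;\upsilon}^{(\mu_{1};\mu_{2};\mu_{3})}(w_{1}\xi,w_{2}y)\,d\xi\,dy$$ $$=z^{p+\sigma-1}t^{q+\tau-1}E_{\frac{\gamma_{1}+\mu_{1}+1}{2},\gamma_{2}+\mu_{2},\gamma_{3}+\mu_{3};p+\sigma;q+\tau;\upsilon}^{(\gamma_{1}+\mu_{1};\gamma_{2}+\mu_{2};\gamma_{3}+\mu_{3})}(w_{1}z,w_{2}t).$$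
   Context: $(a)_n$ is the Pochhammer symbol. The modified I-Konhauser Mittag-Leffler function is $$E_{\gamma_{4},\gamma_{5},\gamma_{6};p;q;\upsilon}^{(\gamma_{1};\gamma_{2};\gamma_{3})}(z,t)=\sum_{l=0}^{\infty}\sum_{n=0}^{\infty}\frac{(-1)^{l}(\gamma_{1})_{2l}(\gamma_{2})_{l+n}(\gamma_{3})_{l}\,z^{l}t^{\upsilon n}}{(\gamma_{4})_{l}(\gamma_{5})_{l}(\gamma_{6})_{l}\,\Gamma(p+l)\,\Gamma(q+\upsilon n)\,n!\,l!}.$$ When $\gamma_4=\frac{\gamma_1+1}{2}$, $\gamma_5=\gamma_2$, $\gamma_6=\gamma_3$ (the only case used here) the equal parameters are understood to be cancelled before substituting values, i.e. for all complex $\gamma_1,\gamma_2,\gamma_3$ $$E_{\frac{\gamma_{1}+1}{2},\gamma_{2},\gamma_{3};p;q;\upsilon}^{(\gamma_{1};\gamma_{2};\gamma_{3})}(z,t)=\sum_{l=0}^{\infty}\sum_{n=0}^{\infty}\frac{(-4)^{l}\left(\frac{\gamma_{1}}{2}\right)_{l}(\gamma_{2}+l)_{n}\,z^{l}t^{\upsilon n}}{\Gamma(p+l)\,\Gamma(q+\upsilon n)\,n!\,l!}.$$ For $s>0$, $(w_2s)^{\upsilon n}$ means $(w_2^{\upsilon})^n s^{\upsilon n}$ with a fixed choice of $w_2^\upsilon$ (and $w_2^{\upsilon}=0$ if $w_2=0$). *)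

theory Defs
  imports "HOL-Analysis.Analysis"
begin

text \<open>
  The parameter-dependent part of the coefficients, that is
  $(-1)^l (\gamma_1)_{2l} (\gamma_2)_{l+n} (\gamma_3)_l / ((\gamma_4)_l (\gamma_5)_l (\gamma_6)_l)$.
  If \<open>\<gamma>4 = (\<gamma>1 + 1) / 2\<close>, \<open>\<gamma>5 = \<gamma>2\<close> and \<open>\<gamma>6 = \<gamma>3\<close>, equal factors are cancelled before values
  are substituted, so that the coefficient is also meaningful when the denominator vanishes;
  wherever the denominator is nonzero this does not change the value
  (lemma \<open>ikml_coeff_eq_quotient\<close>).
\<close>

definition ikml_coeff ::
  "complex \<Rightarrow> complex \<Rightarrow> complex \<Rightarrow> complex \<Rightarrow> complex \<Rightarrow> complex \<Rightarrow> nat \<Rightarrow> nat \<Rightarrow> complex" where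
  "ikml_coeff \<gamma>1 \<gamma>2 \<gamma>3 \<gamma>4 \<gamma>5 \<gamma>6 l n =
     (if \<gamma>4 = (\<gamma>1 + 1) / 2 \<and> \<gamma>5 = \<gamma>2 \<and> \<gamma>6 = \<gamma>3
      then (-4) ^ l * pochhammer (\<gamma>1 / 2) l * pochhammer (\<gamma>2 + of_nat l) n
      else (-1) ^ l * pochhammer \<gamma>1 (2 * l) * pochhammer \<gamma>2 (l + n) * pochhammer \<gamma>3 l /
           (pochhammer \<gamma>4 l * pochhammer \<gamma>5 l * pochhammer \<gamma>6 l))"

lemma ikml_coeff_eq_quotient:
  assumes "pochhammer \<gamma>4 l \<noteq> 0" "pochhammer \<gamma>5 l \<noteq> 0" "pochhammer \<gamma>6 l \<noteq> 0"
  shows "ikml_coeff \<gamma>1 \<gamma>2 \<gamma>3 \<gamma>4 \<gamma>5 \<gamma>6 l n =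
     (-1) ^ l * pochhammer \<gamma>1 (2 * l) * pochhammer \<gamma>2 (l + n) * pochhammer \<gamma>3 l /
     (pochhammer \<gamma>4 l * pochhammer \<gamma>5 l * pochhammer \<gamma>6 l)"
proof (cases "\<gamma>4 = (\<gamma>1 + 1) / 2 \<and> \<gamma>5 = \<gamma>2 \<and> \<gamma>6 = \<gamma>3")
  case True
  have double: "pochhammer \<gamma>1 (2 * l) =
      4 ^ l * pochhammer (\<gamma>1 / 2) l * pochhammer ((\<gamma>1 + 1) / 2) l"
    using pochhammer_double[of "\<gamma>1 / 2" l] by (simp add: add_divide_distrib power_mult)
  have "(-4 :: complex) ^ l = (-1) ^ l * 4 ^ l"
    by (simp flip: power_mult_distrib)
  moreover have eqs: "\<gamma>4 = (\<gamma>1 + 1) / 2" "\<gamma>5 = \<gamma>2" "\<gamma>6 = \<gamma>3"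
    using True by blast+
  ultimately show ?thesis
    using assms unfolding eqs by (simp add: ikml_coeff_def double pochhammer_product')
next
  case False
  then show ?thesis
    unfolding ikml_coeff_def by (rule if_not_P)
qed

text \<open>
  \<open>c\<close> is one of the values of the multivalued power \<open>w\<^sup>a\<close>, with the convention \<open>0\<^sup>a = 0\<close>.
\<close>

definition is_power_value :: "complex \<Rightarrow> complex \<Rightarrow> complex \<Rightarrow> bool" where
  "is_power_value w a c \<longleftrightarrow> (if w = 0 then c = 0 else \<exists>L. exp L = w \<and> c = exp (a * L))"

text \<open>
  The modified I-Konhauser Mittag-Leffler function. Since $t^{\upsilon n}$ is multivalued for a
  complex second argument \<open>t = w * s\<close> with real \<open>s > 0\<close>, that argument is passed as the pair of
  \<open>c\<close>, the chosen value of $w^\upsilon$, and \<open>s\<close>; then $t^{\upsilon n}$ stands for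
  $c^n s^{\upsilon n}$, where $s^{\upsilon n}$ is the principal power.
\<close>

definition ikml ::
  "complex \<Rightarrow> complex \<Rightarrow> complex \<Rightarrow> complex \<Rightarrow> complex \<Rightarrow> complex \<Rightarrow> complex \<Rightarrow> complex \<Rightarrow> complex
    \<Rightarrow> complex \<Rightarrow> complex \<Rightarrow> real \<Rightarrow> complex" where
  "ikml \<gamma>1 \<gamma>2 \<gamma>3 \<gamma>4 \<gamma>5 \<gamma>6 p q \<upsilon> z c s =
     (\<Sum>l. \<Sum>n. ikml_coeff \<gamma>1 \<gamma>2 \<gamma>3 \<gamma>4 \<gamma>5 \<gamma>6 l n * z ^ l *
        (c ^ n * of_real s powr (\<upsilon> * of_nat n)) /
        (Gamma (p + of_nat l) * Gamma (q + \<upsilon> * of_nat n) * fact n * fact l))"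

end

theory Submission
  imports Defs
begin

text \<open>
  Write $k_a(x) = x^{a-1} / \Gamma(a)$ for the Riemann-Liouville kernel. By Euler's Beta integral these
  kernels form a convolution semigroup, $k_a * k_b = k_{a+b}$ for $\Re a, \Re b > 0$
  (lemma \<open>rl_kernel_convolution\<close>). In terms of them
  $$x^{p-1} s^{q-1} E(w x, s) = \sum_{l,n} a_{l,n}\, k_{p+l}(x)\, k_{q+\upsilon n}(s), \qquad
    a_{l,n} = (-4w)^l \frac{(\gamma_1/2)_l}{l!} \, c^n \frac{(\gamma_2+l)_n}{n!}$$
  (lemma \<open>ikml_eq_rl_series\<close>). The integral in the theorem is the double convolution of two such
  functions. By the semigroup law a product of terms with indices $(l,n)$ and $(l',n')$ contributes
  $k_{p+\sigma+l+l'}(z)\, k_{q+\tau+\upsilon(n+n')}(t)$, so the result is again a series of the same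
  kind, and its coefficients form the two-dimensional Cauchy product of the given coefficients.
  But the $a_{l,n}$ are the Taylor coefficients of
  $$(1-cy)^{-\gamma_2} \left(1 + \frac{4wx}{1-cy}\right)^{-\gamma_1/2},$$
  which is multiplicative in $(\gamma_1,\gamma_2)$; hence the Cauchy product belongs to
  $(\gamma_1+\mu_1, \gamma_2+\mu_2)$ (lemma \<open>ikml_gen_coeff_Cauchy_product\<close>, proved by two
  applications of the Vandermonde identity).

  What remains is the interchange of sums and integrals. The coefficients $a_{l,n}$ grow at most
  exponentially in \<open>l\<close> and \<open>n\<close> (lemma \<open>ikml_gen_coeff_bound\<close>), while $1/|\Gamma(q+\omega n)|$ decays
  faster than every exponential when $\Re\omega > 0$, even for non-real $\omega$
  (lemma \<open>summable_power_rGamma\<close>). So every series is dominated by an integrable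
  Beta weight $(z-x)^{\Re p-1} x^{\Re\sigma-1}$ times a summable sequence
  (lemma \<open>dominated_series_integral\<close>). One-dimensional convolution of kernel series
  (lemma \<open>rl_series_convolution\<close>) is used with step \<open>1\<close> for the inner integral, at fixed \<open>y\<close>,
  and with step \<open>\<upsilon>\<close> for each coefficient in the outer integral.
\<close>

section \<open>The convolution semigroup of Riemann-Liouville kernels\<close>

text \<open>
  Using the entire function \<open>rGamma\<close> avoids division by \<open>Gamma\<close>. Real negative \<open>x\<close> give the principal
  power, so the kernel is not the usual one supported on the positive axis; the integrals below
  restrict to positive arguments instead.
\<close>

definition rl_kernel :: "complex \<Rightarrow> real \<Rightarrow> complex" where
  "rl_kernel a x = of_real x powr (a - 1) * rGamma a"

text \<open>
  The principal power jumps across the negative real axis, so continuity does not give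
  measurability on the whole line; the explicit form of the logarithm on the real axis does.
\<close>

lemma borel_measurable_of_real_powr [measurable]:
  "(\<lambda>x. of_real x powr a :: complex) \<in> borel_measurable borel"
proof -
  have "(\<lambda>x. of_real x powr a :: complex) = (\<lambda>x. if x = 0 then 0 else
      exp (a * (of_real (ln \<bar>x\<bar>) + of_real (if x < 0 then pi else 0) * \<i>)))"
    by (auto simp: powr_def Ln_of_real')
  thus ?thesis by simp
qed

lemma rl_kernel_measurable [measurable]: "rl_kernel a \<in> borel_measurable borel"
  unfolding rl_kernel_def by (intro borel_measurable_times) auto

lemma norm_rl_kernel: "x > 0 \<Longrightarrow> norm (rl_kernel a x) = x powr (Re a - 1) * norm (rGamma a)"
  unfolding rl_kernel_def by (simp add: norm_mult norm_powr_real_powr)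

lemma rl_kernel_scale:
  assumes "u > 0" "x > 0"
  shows "rl_kernel a (u * x) = of_real u powr (a - 1) * rl_kernel a x"
  unfolding rl_kernel_def using assms by (simp add: powr_times_real)

text \<open>
  This weight dominates every product of two kernel series, and so carries all the dominated
  convergence arguments. It is the rescaling to \<open>{0<..<u}\<close> of the integrand of the Beta integral.
\<close>

lemma integrable_beta_weight:
  fixes \<alpha> \<beta> u :: real
  assumes "\<alpha> > 0" "\<beta> > 0" "u > 0"
  shows "set_integrable lborel {0<..<u} (\<lambda>x. (u - x) powr (\<alpha> - 1) * x powr (\<beta> - 1))"
proof -
  have "set_integrable lborel {0..1} (\<lambda>t. t powr (\<beta> - 1) * (1 - t) powr (\<alpha> - 1))"
    using integrable_Beta assms by blast
  hence "set_integrable lborel {0<..<1} (\<lambda>t. t powr (\<beta> - 1) * (1 - t) powr (\<alpha> - 1))"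
    by (rule set_integrable_subset) auto
  hence "integrable lborel (\<lambda>t. u powr (\<alpha> + \<beta> - 2) *
      (indicator {0<..<1} t *\<^sub>R (t powr (\<beta> - 1) * (1 - t) powr (\<alpha> - 1))))"
    unfolding set_integrable_def by (rule integrable_mult_right)
  from lborel_integrable_real_affine[OF this, of "1 / u" 0] assms
  have "integrable lborel (\<lambda>x. u powr (\<alpha> + \<beta> - 2) * (indicator {0<..<1} (x / u) *\<^sub>R
      ((x / u) powr (\<beta> - 1) * (1 - x / u) powr (\<alpha> - 1))))"
    by simp
  also have "(\<lambda>x. u powr (\<alpha> + \<beta> - 2) * (indicator {0<..<1} (x / u) *\<^sub>R
      ((x / u) powr (\<beta> - 1) * (1 - x / u) powr (\<alpha> - 1)))) =
      (\<lambda>x. indicator {0<..<u} x *\<^sub>R ((u - x) powr (\<alpha> - 1) * x powr (\<beta> - 1)))"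
  proof
    fix x
    show "u powr (\<alpha> + \<beta> - 2) * (indicator {0<..<1} (x / u) *\<^sub>R
        ((x / u) powr (\<beta> - 1) * (1 - x / u) powr (\<alpha> - 1))) =
        indicator {0<..<u} x *\<^sub>R ((u - x) powr (\<alpha> - 1) * x powr (\<beta> - 1))"
    proof (cases "x \<in> {0<..<u}")
      case True
      hence "1 - x / u = (u - x) / u" using assms by (simp add: field_simps)
      moreover have "u powr (\<alpha> + \<beta> - 2) = u powr (\<alpha> - 1) * u powr (\<beta> - 1)"
        by (simp flip: powr_add)
      ultimately show ?thesis using True assms by (simp add: powr_divide field_simps)
    qed (use assms in \<open>auto simp: indicator_def field_simps\<close>)
  qed
  finally show ?thesis unfolding set_integrable_def .
qed

text \<open>
  Euler's integral, normalised: \<open>rl_kernel a x * exp (-x)\<close> is a (complex) Gamma probability density.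
\<close>

lemma rl_kernel_exp_integral:
  assumes "Re a > 0"
  shows "integrable lborel (\<lambda>x. indicator {0<..} x *\<^sub>R (rl_kernel a x * of_real (exp (-x))))" (is ?I)
    and "(\<integral>x. indicator {0<..} x *\<^sub>R (rl_kernel a x * of_real (exp (-x))) \<partial>lborel) = 1" (is ?E)
proof -
  have eq: "rl_kernel a x * of_real (exp (-x)) =
      (of_real x powr (a - 1) / of_real (exp x)) * rGamma a" for x
    by (auto simp: rl_kernel_def exp_minus field_simps)
  have "set_integrable lebesgue {0<..} (\<lambda>x. of_real x powr (a - 1) / of_real (exp x) :: complex)"
    using absolutely_integrable_Gamma_integral'[OF assms] .
  hence 1: "set_integrable lborel {0<..} (\<lambda>x. of_real x powr (a - 1) / of_real (exp x) :: complex)"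
    unfolding set_integrable_def by (subst (asm) integrable_completion) auto
  hence "set_integrable lborel {0<..} (\<lambda>x. of_real x powr (a - 1) / of_real (exp x) * rGamma a)"
    by (intro set_integrable_mult_left)
  thus ?I unfolding eq set_integrable_def .
  have "(LBINT x:{0<..}. of_real x powr (a - 1) / of_real (exp x) :: complex) = Gamma a"
    using set_borel_integral_eq_integral(2)[OF 1] Gamma_integral_complex'[OF assms]
    by (simp add: has_integral_iff)
  moreover have "a \<notin> \<int>\<^sub>\<le>\<^sub>0" using assms by (auto elim!: nonpos_Ints_cases')
  ultimately show ?E unfolding eq
    unfolding set_lebesgue_integral_def[symmetric] set_integral_mult_left
    by (simp add: rGamma_inverse_Gamma Gamma_eq_zero_iff)
qed

lemma rl_kernel_convolution_integrable:
  assumes "Re a > 0" "Re b > 0" "u > 0"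
  shows "set_integrable lborel {0<..<u} (\<lambda>x. rl_kernel a (u - x) * rl_kernel b x)"
proof (rule set_integrable_bound)
  show "set_integrable lborel {0<..<u} (\<lambda>x. norm (rGamma a * rGamma b) *
      ((u - x) powr (Re a - 1) * x powr (Re b - 1)))"
    using integrable_beta_weight[OF assms] by simp
qed (auto simp: set_borel_measurable_def norm_mult norm_rl_kernel)

text \<open>
  The Beta integral with complex parameters. The densities $f_a(x) = k_a(x) e^{-x}$ have
  integral 1, hence so does $f_b * f_a$ by Fubini. By scaling, the convolution of the kernels is
  $u^{a+b-1} C$ with a constant \<open>C\<close>, so $f_b * f_a$ is $C\,\Gamma(a+b)$ times $f_{a+b}$; comparing the
  total integrals gives \<open>C = rGamma (a + b)\<close>.
\<close>

lemma rl_kernel_convolution: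
  assumes "Re a > 0" "Re b > 0" "u > 0"
  shows "(LBINT x:{0<..<u}. rl_kernel a (u - x) * rl_kernel b x) = rl_kernel (a + b) u"
proof -
  define f where "f a x = indicator {0<..} x *\<^sub>R (rl_kernel a x * of_real (exp (-x)))" for a x
  have f_meas [measurable]: "f a \<in> borel_measurable borel" for a
    unfolding f_def by measurable
  have f_int: "integrable lborel (f a)" "(\<integral>x. f a x \<partial>lborel) = 1" if "Re a > 0" for a
    using rl_kernel_exp_integral[OF that] unfolding f_def by auto
  have shift_int: "integrable lborel (\<lambda>u. f a (u - x))" for x
    using lborel_integrable_real_affine[OF f_int(1)[OF assms(1)], of 1 "-x"] by simp
  have shift_eq: "(\<integral>u. g (u - x) \<partial>lborel) = (\<integral>u. g u \<partial>lborel)" 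
    for g :: "real \<Rightarrow> 'b::{banach,second_countable_topology}" and x
    using lborel_integral_real_affine[of 1 g "-x"] by simp
  have prod_int: "integrable (lborel \<Otimes>\<^sub>M lborel) (\<lambda>(x, u). f b x * f a (u - x))"
  proof (rule lborel_pair.Fubini_integrable)
    show "(\<lambda>(x, u). f b x * f a (u - x)) \<in> borel_measurable (lborel \<Otimes>\<^sub>M lborel)"
      by measurable
    have "(\<lambda>x. \<integral>u. norm (case (x, u) of (x, u) \<Rightarrow> f b x * f a (u - x)) \<partial>lborel) =
        (\<lambda>x. norm (f b x) * (\<integral>u. norm (f a u) \<partial>lborel))"
      using shift_eq[of "\<lambda>u. norm (f a u)"] by (simp add: norm_mult)
    thus "integrable lborel (\<lambda>x. \<integral>u. norm (case (x, u) of (x, u) \<Rightarrow> f b x * f a (u - x)) \<partial>lborel)"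
      using f_int(1)[OF assms(2)] by simp
  qed (use shift_int in auto)
  have total: "(\<integral>u. \<integral>x. f b x * f a (u - x) \<partial>lborel \<partial>lborel) = 1"
  proof -
    have "(\<integral>u. \<integral>x. f b x * f a (u - x) \<partial>lborel \<partial>lborel) = (\<integral>x. \<integral>u. f b x * f a (u - x) \<partial>lborel \<partial>lborel)"
      using lborel_pair.Fubini_integral[OF prod_int] .
    also have "\<dots> = (\<integral>x. f b x * (\<integral>u. f a u \<partial>lborel) \<partial>lborel)"
      using shift_eq[of "f a"] by simp
    finally show ?thesis using f_int assms by simp
  qed
  define C where "C = (LBINT x:{0<..<1}. rl_kernel a (1 - x) * rl_kernel b x)"
  have scale: "(LBINT x:{0<..<u}. rl_kernel a (u - x) * rl_kernel b x) = of_real u powr (a + b - 1) * C"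
    if "u > 0" for u
  proof -
    have "(LBINT x:{0<..<u}. rl_kernel a (u - x) * rl_kernel b x) =
        of_real u * (\<integral>x. indicator {0<..<u} (u * x) *\<^sub>R (rl_kernel a (u - u * x) * rl_kernel b (u * x)) \<partial>lborel)"
      unfolding set_lebesgue_integral_def
      by (subst lborel_integral_real_affine[of u _ 0]) (use that in \<open>auto simp: scaleR_conv_of_real\<close>)
    also have "(\<lambda>x. indicator {0<..<u} (u * x) *\<^sub>R (rl_kernel a (u - u * x) * rl_kernel b (u * x))) =
        (\<lambda>x. of_real u powr (a - 1 + (b - 1)) * (indicator {0<..<1} x *\<^sub>R (rl_kernel a (1 - x) * rl_kernel b x)))"
    proof
      fix x
      show "indicator {0<..<u} (u * x) *\<^sub>R (rl_kernel a (u - u * x) * rl_kernel b (u * x)) =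
        of_real u powr (a - 1 + (b - 1)) * (indicator {0<..<1} x *\<^sub>R (rl_kernel a (1 - x) * rl_kernel b x))"
      proof (cases "x \<in> {0<..<1}")
        case True
        hence "u - u * x = u * (1 - x)" by (simp add: algebra_simps)
        thus ?thesis unfolding powr_add using True that by (simp add: rl_kernel_scale)
      qed (use that in \<open>auto simp: indicator_def mult_less_cancel_left2 zero_less_mult_iff\<close>)
    qed
    also have "of_real u * (\<integral>x. of_real u powr (a - 1 + (b - 1)) * (indicator {0<..<1} x *\<^sub>R (rl_kernel a (1 - x) * rl_kernel b x))
        \<partial>lborel) =
        of_real u * of_real u powr (a - 1 + (b - 1)) * C"
      unfolding C_def set_lebesgue_integral_def integral_mult_right_zero by (rule mult.assoc[symmetric])
    also have "of_real u * of_real u powr (a - 1 + (b - 1)) = (of_real u powr (a + b - 1) :: complex)"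
      using powr_add[of "complex_of_real u" 1 "a - 1 + (b - 1)"] that by (simp add: algebra_simps)
    finally show ?thesis .
  qed
  have inner: "(\<integral>x. f b x * f a (u - x) \<partial>lborel) * rGamma (a + b) = f (a + b) u * C" for u
  proof (cases "u > 0")
    case True
    have "(\<lambda>x. f b x * f a (u - x)) = (\<lambda>x. of_real (exp (-u)) *
        (indicator {0<..<u} x *\<^sub>R (rl_kernel a (u - x) * rl_kernel b x)))"
      by (auto simp: f_def indicator_def fun_eq_iff exp_diff exp_minus field_simps)
    hence "(\<integral>x. f b x * f a (u - x) \<partial>lborel) = of_real (exp (-u)) * (of_real u powr (a + b - 1) * C)"
      using scale[OF True] unfolding set_lebesgue_integral_def by (simp only: integral_mult_right_zero)
    thus ?thesis using True by (simp add: f_def rl_kernel_def)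
  next
    case False
    hence "(\<lambda>x. f b x * f a (u - x)) = (\<lambda>x. 0)" "f (a + b) u = 0"
      by (auto simp: f_def indicator_def)
    thus ?thesis by simp
  qed
  have "rGamma (a + b) = (\<integral>u. (\<integral>x. f b x * f a (u - x) \<partial>lborel) * rGamma (a + b) \<partial>lborel)"
    using total by simp
  also have "\<dots> = C"
    unfolding inner using f_int[of "a + b"] assms by simp
  finally show ?thesis using scale[OF assms(3)] by (simp add: rl_kernel_def)
qed

section \<open>Decay of the reciprocal Gamma function along a ray\<close>

text \<open>
  Factor by factor: $|1 + iy/(x+k)|$ decreases in \<open>x\<close>, so on $x \ge 1$ each factor is largest at
  \<open>x = 1\<close>. The factorial is \<open>pochhammer 1 n\<close>.
\<close>

lemma norm_pochhammer_ratio: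
  fixes x y :: real
  assumes "x \<ge> 1"
  shows "norm (pochhammer (Complex x y) n) * fact n \<le> pochhammer x n * norm (pochhammer (Complex 1 y) n)"
proof (induction n)
  case (Suc n)
  let ?k = "real n"
  have "norm (Complex x y + of_nat n) * (1 + ?k) \<le> (x + ?k) * norm (Complex 1 y + of_nat n)"
  proof (rule power2_le_imp_le)
    have "y\<^sup>2 * (1 + ?k)\<^sup>2 \<le> y\<^sup>2 * (x + ?k)\<^sup>2"
      using assms by (intro mult_left_mono power_mono) auto
    thus "(norm (Complex x y + of_nat n) * (1 + ?k))\<^sup>2 \<le> ((x + ?k) * norm (Complex 1 y + of_nat n))\<^sup>2"
      unfolding power_mult_distrib cmod_power2 by (simp add: algebra_simps)
  qed (use assms in auto)
  from mult_mono[OF Suc.IH this] show ?case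
    using assms by (simp add: pochhammer_Suc norm_mult pochhammer_nonneg mult_ac)
qed simp

text \<open>
  Moving off the real axis costs no more than it does on the vertical line through \<open>1\<close>: in
  Euler's limit for $1/\Gamma$, the ratio $|\Gamma(x)/\Gamma(x+iy)|$ is the limit of the products bounded in
  \<open>norm_pochhammer_ratio\<close>.
\<close>

lemma norm_rGamma_le_vertical:
  fixes x y :: real
  assumes "x \<ge> 1"
  shows "norm (rGamma (Complex x y)) \<le> rGamma x * norm (rGamma (Complex 1 y))"
proof (rule tendsto_le[OF sequentially_bot])
  show "(\<lambda>n. norm (rGamma_series (Complex x y) n)) \<longlonglongrightarrow> norm (rGamma (Complex x y))"
    by (intro tendsto_intros)
  show "(\<lambda>n. rGamma_series x n * norm (rGamma_series (Complex 1 y) n)) \<longlonglongrightarrow>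
      rGamma x * norm (rGamma (Complex 1 y))"
    by (intro tendsto_intros)
  show "\<forall>\<^sub>F n in sequentially. norm (rGamma_series (Complex x y) n) \<le>
      rGamma_series x n * norm (rGamma_series (Complex 1 y) n)"
    using eventually_gt_at_top[of 0]
  proof eventually_elim
    case (elim n)
    define P Q S where "P = norm (pochhammer (Complex x y) (n + 1))"
      and "Q = pochhammer x (n + 1)" and "S = norm (pochhammer (Complex 1 y) (n + 1))"
    have "P * (real n * fact n) \<le> P * fact (n + 1)"
      by (intro mult_left_mono) (auto simp: P_def algebra_simps)
    also have "\<dots> \<le> Q * S"
      unfolding P_def Q_def S_def by (rule norm_pochhammer_ratio[OF assms])
    finally have "P * (real n * fact n) / (fact n * exp (x * ln n) * (fact n * real n)) \<le>
        Q * S / (fact n * exp (x * ln n) * (fact n * real n))"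
      by (rule divide_right_mono) auto
    hence "P / (fact n * exp (x * ln n)) \<le> Q / (fact n * exp (x * ln n)) * (S / (fact n * real n))"
      using elim by (simp add: field_simps)
    thus ?case
      using elim
      unfolding rGamma_series_def P_def Q_def S_def
      by (simp add: norm_divide norm_mult)
  qed
qed

text \<open>
  On the vertical line through \<open>1\<close> the reflection formula gives the exact value
  $|1/\Gamma(1+iy)|^2 = \sinh(\pi|y|) / (\pi|y|)$, and $\sinh t \le t e^t$.
\<close>

lemma norm_rGamma_one_plus_imaginary_le: "norm (rGamma (Complex 1 y)) \<le> exp (pi * \<bar>y\<bar>)"
proof (cases "y = 0")
  case False
  define t where "t = pi * \<bar>y\<bar>"
  define N where "N = norm (rGamma (Complex 1 y))"
  have t: "t > 0" using False by (simp add: t_def)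
  have one: "1 + \<i> * of_real y = Complex 1 y" "1 - \<i> * of_real y = cnj (Complex 1 y)"
    by (simp_all add: complex_eq_iff)
  have "rGamma (\<i> * of_real y) = \<i> * of_real y * rGamma (Complex 1 y)"
    using rGamma_plus1[of "\<i> * of_real y"] one by (simp add: add.commute)
  moreover have "rGamma (1 - \<i> * of_real y) = cnj (rGamma (Complex 1 y))"
    unfolding one by (simp add: cnj_rGamma)
  ultimately have "norm (\<i> * of_real y * rGamma (Complex 1 y) * cnj (rGamma (Complex 1 y))) =
      norm (sin (of_real pi * (\<i> * of_real y))) / pi"
    using arg_cong[OF rGamma_reflection_complex[of "\<i> * of_real y"], of norm]
    by (simp add: norm_divide)
  hence "\<bar>y\<bar> * N\<^sup>2 = norm (sin (of_real pi * (\<i> * of_real y))) / pi"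
    by (simp add: norm_mult N_def power2_eq_square)
  hence 1: "t * N\<^sup>2 = norm (sin (of_real pi * (\<i> * of_real y)))"
    by (simp add: t_def field_simps)
  have "norm (sin (of_real pi * (\<i> * of_real y))) = \<bar>exp (- (pi * y)) - exp (pi * y)\<bar> / 2"
  proof -
    have "sin (of_real pi * (\<i> * of_real y)) = of_real (exp (- (pi * y)) - exp (pi * y)) / (2 * \<i>)"
    proof -
      have "\<i> * (of_real pi * (\<i> * of_real y)) = complex_of_real (- (pi * y))"
        by (simp add: complex_eq_iff)
      thus ?thesis unfolding sin_exp_eq by (simp only: exp_of_real) (simp flip: exp_of_real)
    qed
    thus ?thesis by (simp add: norm_divide norm_mult flip: of_real_diff)
  qed
  also have "\<dots> = (exp t - exp (-t)) / 2"
    using False by (auto simp: t_def abs_if mult_less_0_iff zero_less_mult_iff)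
  also have "\<dots> \<le> t * exp t"
  proof -
    have "(1 - 2 * t) * exp t \<le> exp (- 2 * t) * exp t"
      using exp_ge_add_one_self[of "-2 * t"] by (intro mult_right_mono) auto
    also have "exp (- 2 * t) * exp t = exp (-t)" by (simp flip: exp_add)
    finally show ?thesis by (simp add: algebra_simps)
  qed
  finally have "t * N\<^sup>2 \<le> t * exp t" using 1 by simp
  hence "N\<^sup>2 \<le> exp t" using t by (simp only: mult_le_cancel_left_pos)
  also have "exp t \<le> (exp t)\<^sup>2" using t by (simp add: power2_eq_square)
  finally show ?thesis unfolding N_def t_def by (rule power2_le_imp_le) auto
qed (simp add: Complex_eq)

text \<open>
  Restrict Euler's integral to the unit interval from \<open>S\<close> to \<open>S + 1\<close>. As \<open>S\<close> is arbitrary, \<open>Gamma\<close> beats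
  every exponential.
\<close>

lemma Gamma_ge_powr:
  fixes x S :: real
  assumes "x \<ge> 1" "S > 0"
  shows "Gamma x \<ge> S powr (x - 1) / exp (S + 1)"
proof (rule has_integral_le[where i = "S powr (x - 1) / exp (S + 1)"])
  have "((\<lambda>_. S powr (x - 1) / exp (S + 1)) has_integral S powr (x - 1) / exp (S + 1)) {S..S+1}"
    using has_integral_const_real[of "S powr (x - 1) / exp (S + 1)" S "S + 1"] by simp
  thus "((\<lambda>s. if s \<in> {S..S+1} then S powr (x - 1) / exp (S + 1) else 0) has_integral
      S powr (x - 1) / exp (S + 1)) {0..}"
    by (subst has_integral_restrict) (use assms in auto)
  show "((\<lambda>t. t powr (x - 1) / exp t) has_integral Gamma x) {0..}"
    using assms by (intro Gamma_integral_real) auto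
qed (use assms in \<open>auto intro!: frac_le powr_mono2\<close>)

text \<open>
  Along the ray, $1/\Gamma$ is bounded by its value on the real axis times $e^{\pi|y|}$, where \<open>y\<close> is the
  imaginary part. The latter is only exponential in \<open>n\<close>, while the former is
  $O(S^{-n \Re\omega})$ for every \<open>S\<close>.
\<close>

lemma summable_power_rGamma:
  fixes q \<omega> :: complex and R :: real
  assumes "Re \<omega> > 0" "R \<ge> 0"
  shows "summable (\<lambda>n. R ^ n * norm (rGamma (q + of_nat n * \<omega>)))"
proof (rule summable_comparison_test_ev)
  define E where "E = exp (pi * \<bar>Im \<omega>\<bar>)"
  \<comment> \<open>This value of S bounds the n-th term by a multiple of \<open>(R / (R + 1)) ^ n / 2 ^ n\<close>; using \<open>R + 1\<close>
    rather than \<open>R\<close> keeps S positive when \<open>R = 0\<close>.\<close>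
  define S where "S = (2 * (R + 1) * E) powr (1 / Re \<omega>)"
  define K where "K = exp (S + 1) * S powr (1 - Re q) * exp (pi * \<bar>Im q\<bar>)"
  have E: "E > 0" by (simp add: E_def)
  have S: "S > 0" using assms E by (simp add: S_def)
  have S_powr: "S powr Re \<omega> = 2 * (R + 1) * E"
    using assms E by (simp add: S_def powr_powr)
  show "summable (\<lambda>n. K * (1 / 2) ^ n)" by (intro summable_mult summable_geometric) auto
  have "filterlim (\<lambda>n. Re q + real n * Re \<omega>) at_top sequentially"
    using assms filterlim_real_sequentially
    by (intro filterlim_tendsto_add_at_top[OF tendsto_const] filterlim_at_top_mult_tendsto_pos[where c="Re \<omega>"]) auto
  hence "\<forall>\<^sub>F n in sequentially. Re q + real n * Re \<omega> \<ge> 1"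
    by (simp add: filterlim_at_top)
  thus "\<forall>\<^sub>F n in sequentially. norm (R ^ n * norm (rGamma (q + of_nat n * \<omega>))) \<le> K * (1 / 2) ^ n"
  proof eventually_elim
    case (elim n)
    define x y where "x = Re q + real n * Re \<omega>" and "y = Im q + real n * Im \<omega>"
    have x: "x \<ge> 1" using elim by (simp add: x_def)
    have "rGamma x \<le> exp (S + 1) * S powr (1 - x)"
    proof -
      have "S powr (x - 1) / exp (S + 1) \<le> Gamma x" by (rule Gamma_ge_powr[OF x S])
      hence "inverse (Gamma x) \<le> inverse (S powr (x - 1) / exp (S + 1))"
        using S by (intro le_imp_inverse_le) auto
      thus ?thesis using powr_minus[of S "x - 1"] by (simp add: rGamma_inverse_Gamma field_simps)
    qed
    moreover have "norm (rGamma (Complex 1 y)) \<le> exp (pi * \<bar>Im q\<bar>) * E ^ n"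
    proof -
      have "norm (rGamma (Complex 1 y)) \<le> exp (pi * \<bar>y\<bar>)"
        by (rule norm_rGamma_one_plus_imaginary_le)
      also have "\<dots> \<le> exp (pi * (\<bar>Im q\<bar> + real n * \<bar>Im \<omega>\<bar>))"
        using abs_triangle_ineq[of "Im q" "real n * Im \<omega>"] by (simp add: y_def abs_mult)
      also have "\<dots> = exp (pi * \<bar>Im q\<bar>) * E ^ n"
        by (simp add: E_def ring_distribs exp_add mult_ac flip: exp_of_nat_mult)
      finally show ?thesis .
    qed
    ultimately have "rGamma x * norm (rGamma (Complex 1 y)) \<le>
        (exp (S + 1) * S powr (1 - x)) * (exp (pi * \<bar>Im q\<bar>) * E ^ n)"
      by (intro mult_mono) auto
    moreover have "norm (rGamma (q + of_nat n * \<omega>)) \<le> rGamma x * norm (rGamma (Complex 1 y))"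
    proof -
      have "q + of_nat n * \<omega> = Complex x y" by (simp add: complex_eq_iff x_def y_def)
      thus ?thesis using norm_rGamma_le_vertical[OF x] by simp
    qed
    moreover have "S powr (1 - x) = S powr (1 - Re q) / (2 * (R + 1) * E) ^ n"
    proof -
      have "S powr (1 - x) = S powr (1 - Re q) / S powr (Re \<omega> * real n)"
        by (simp add: x_def algebra_simps flip: powr_diff)
      also have "S powr (Re \<omega> * real n) = (2 * (R + 1) * E) ^ n"
        using S E assms by (simp add: S_powr powr_realpow flip: powr_powr)
      finally show ?thesis .
    qed
    ultimately have "norm (rGamma (q + of_nat n * \<omega>)) \<le>
        (exp (S + 1) * (S powr (1 - Re q) / (2 * (R + 1) * E) ^ n)) * (exp (pi * \<bar>Im q\<bar>) * E ^ n)"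
      by simp
    also have "\<dots> = K * (1 / 2) ^ n * (1 / (R + 1) ^ n)"
      unfolding power_mult_distrib K_def using E by (simp add: power_one_over field_simps)
    finally have "norm (rGamma (q + of_nat n * \<omega>)) \<le> K * (1 / 2) ^ n * (1 / (R + 1) ^ n)" .
    hence "R ^ n * norm (rGamma (q + of_nat n * \<omega>)) \<le> R ^ n * (K * (1 / 2) ^ n * (1 / (R + 1) ^ n))"
      using assms by (intro mult_left_mono) auto
    also have "\<dots> = (K * (1 / 2) ^ n) * (R / (R + 1)) ^ n"
      by (simp add: power_divide)
    also have "\<dots> \<le> (K * (1 / 2) ^ n) * 1"
      using assms by (intro mult_left_mono power_le_one) (auto simp: K_def)
    finally show ?case using assms by simp
  qed
qed

section \<open>Coefficients of the generating function\<close>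

text \<open>
  The induction proves the sharper bound \<open>fact n * ((k + n) choose n)\<close>.
\<close>

lemma norm_pochhammer_le:
  fixes z :: "'a :: real_normed_field"
  assumes "norm z \<le> real k"
  shows "norm (pochhammer z n / fact n) \<le> 2 ^ (k + n)"
proof -
  have "norm (pochhammer z n) \<le> fact n * real ((k + n) choose n)"
  proof (induction n)
    case (Suc n)
    have "norm (z + of_nat n) \<le> real (k + n)"
      using norm_triangle_ineq[of z "of_nat n"] assms by simp
    hence "norm (pochhammer z (Suc n)) \<le> fact n * real ((k + n) choose n) * real (k + n)"
      unfolding pochhammer_Suc norm_mult using Suc.IH by (intro mult_mono) auto
    also have "\<dots> \<le> fact n * (real ((k + n) choose n) * real (Suc (k + n)))"
      by (simp add: mult_left_mono)
    also have "real ((k + n) choose n) * real (Suc (k + n)) = real (Suc n) * real (Suc (k + n) choose Suc n)"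
      using Suc_times_binomial_eq[of "k + n" n] by (metis mult.commute of_nat_mult)
    finally show ?case by (simp add: algebra_simps)
  qed simp
  also have "real ((k + n) choose n) \<le> 2 ^ (k + n)"
    using binomial_le_pow2[of "k + n" n] by (metis of_nat_le_iff of_nat_numeral of_nat_power)
  finally show ?thesis by (simp add: norm_divide field_simps)
qed

text \<open>
  Coefficientwise form of $(1-x)^{-a} (1-x)^{-b} = (1-x)^{-(a+b)}$.
\<close>

lemma pochhammer_Cauchy_product:
  fixes a b :: "'a :: field_char_0"
  shows "(\<Sum>k\<le>n. pochhammer a k / fact k * (pochhammer b (n - k) / fact (n - k))) = pochhammer (a + b) n / fact n"
  unfolding pochhammer_binomial_sum sum_divide_distrib
  by (intro sum.cong) (auto simp: binomial_fact field_simps)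

text \<open>
  The coefficient of $x^l y^n$ in $(1-cy)^{-\gamma_2} (1 + 4wx/(1-cy))^{-\gamma_1/2}$.
\<close>

definition ikml_gen_coeff :: "complex \<Rightarrow> complex \<Rightarrow> complex \<Rightarrow> complex \<Rightarrow> nat \<Rightarrow> nat \<Rightarrow> complex" where
  "ikml_gen_coeff w c \<gamma>1 \<gamma>2 l n =
     (-4 * w) ^ l * (pochhammer (\<gamma>1 / 2) l / fact l) * (c ^ n * (pochhammer (\<gamma>2 + of_nat l) n / fact n))"

text \<open>
  The generating function is multiplicative in $(\gamma_1,\gamma_2)$. On coefficients: at fixed \<open>l\<close> the
  Vandermonde sum over \<open>n\<close> has the parameter $(\gamma_2 + l) + (\mu_2 + L - l) = \gamma_2 + \mu_2 + L$, so
  its value does not depend on \<open>l\<close>, and a second Vandermonde sum over \<open>l\<close> remains.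
\<close>

lemma ikml_gen_coeff_Cauchy_product:
  "(\<Sum>l\<le>L. \<Sum>n\<le>N. ikml_gen_coeff w c \<gamma>1 \<gamma>2 l n * ikml_gen_coeff w c \<mu>1 \<mu>2 (L - l) (N - n)) =
    ikml_gen_coeff w c (\<gamma>1 + \<mu>1) (\<gamma>2 + \<mu>2) L N"
proof -
  let ?P = "\<lambda>a k. pochhammer a k / fact k :: complex"
  have "(\<Sum>n\<le>N. ikml_gen_coeff w c \<gamma>1 \<gamma>2 l n * ikml_gen_coeff w c \<mu>1 \<mu>2 (L - l) (N - n)) =
      (-4 * w) ^ L * (c ^ N * ?P (\<gamma>2 + \<mu>2 + of_nat L) N) * (?P (\<gamma>1 / 2) l * ?P (\<mu>1 / 2) (L - l))"
    if "l \<le> L" for l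
  proof -
    have "(\<gamma>2 + of_nat l) + (\<mu>2 + of_nat (L - l)) = \<gamma>2 + \<mu>2 + of_nat L"
      using that by (simp add: of_nat_diff)
    hence vand: "(\<Sum>n\<le>N. ?P (\<gamma>2 + of_nat l) n * ?P (\<mu>2 + of_nat (L - l)) (N - n)) =
        ?P (\<gamma>2 + \<mu>2 + of_nat L) N"
      by (simp only: pochhammer_Cauchy_product)
    have "(\<Sum>n\<le>N. ikml_gen_coeff w c \<gamma>1 \<gamma>2 l n * ikml_gen_coeff w c \<mu>1 \<mu>2 (L - l) (N - n)) =
        (\<Sum>n\<le>N. (-4 * w) ^ L * c ^ N * (?P (\<gamma>1 / 2) l * ?P (\<mu>1 / 2) (L - l)) *
          (?P (\<gamma>2 + of_nat l) n * ?P (\<mu>2 + of_nat (L - l)) (N - n)))"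
    proof (intro sum.cong refl)
      fix n assume "n \<in> {..N}"
      hence "(-4 * w) ^ L = (-4 * w) ^ l * (-4 * w) ^ (L - l)" "c ^ N = c ^ n * c ^ (N - n)"
        using that by (simp_all flip: power_add)
      thus "ikml_gen_coeff w c \<gamma>1 \<gamma>2 l n * ikml_gen_coeff w c \<mu>1 \<mu>2 (L - l) (N - n) =
          (-4 * w) ^ L * c ^ N * (?P (\<gamma>1 / 2) l * ?P (\<mu>1 / 2) (L - l)) *
          (?P (\<gamma>2 + of_nat l) n * ?P (\<mu>2 + of_nat (L - l)) (N - n))"
        unfolding ikml_gen_coeff_def by (simp only: mult_ac)
    qed
    also have "\<dots> = (-4 * w) ^ L * c ^ N * (?P (\<gamma>1 / 2) l * ?P (\<mu>1 / 2) (L - l)) * ?P (\<gamma>2 + \<mu>2 + of_nat L) N"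
      unfolding sum_distrib_left[symmetric] vand ..
    finally show ?thesis by (simp only: mult_ac)
  qed
  hence "(\<Sum>l\<le>L. \<Sum>n\<le>N. ikml_gen_coeff w c \<gamma>1 \<gamma>2 l n * ikml_gen_coeff w c \<mu>1 \<mu>2 (L - l) (N - n)) =
      (-4 * w) ^ L * (c ^ N * ?P (\<gamma>2 + \<mu>2 + of_nat L) N) * (\<Sum>l\<le>L. ?P (\<gamma>1 / 2) l * ?P (\<mu>1 / 2) (L - l))"
    by (simp add: sum_distrib_left)
  also have "(\<Sum>l\<le>L. ?P (\<gamma>1 / 2) l * ?P (\<mu>1 / 2) (L - l)) = ?P ((\<gamma>1 + \<mu>1) / 2) L"
    unfolding pochhammer_Cauchy_product by (simp add: add_divide_distrib)
  finally show ?thesis unfolding ikml_gen_coeff_def by (simp only: mult_ac)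
qed

text \<open>
  Each Pochhammer quotient costs a factor 2 per unit of its index and of its parameter; the index \<open>l\<close>
  enters both, once as an index and once through the parameter $\gamma_2 + l$, which turns 4 into 16.
\<close>

lemma ikml_gen_coeff_bound:
  obtains K where "K \<ge> 0"
    "\<And>l n. norm (ikml_gen_coeff w c \<gamma>1 \<gamma>2 l n) \<le> K * (16 * norm w) ^ l * (2 * norm c) ^ n"
proof -
  obtain i j where ij: "norm (\<gamma>1 / 2) \<le> real i" "norm \<gamma>2 \<le> real j"
    using real_arch_simple by metis
  have "norm (ikml_gen_coeff w c \<gamma>1 \<gamma>2 l n) \<le> 2 ^ (i + j) * (16 * norm w) ^ l * (2 * norm c) ^ n" for l n
  proof -
    have "norm (\<gamma>2 + of_nat l) \<le> real (j + l)"
      using norm_triangle_ineq[of \<gamma>2 "of_nat l"] ij by simp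
    hence "norm (pochhammer (\<gamma>2 + of_nat l) n / fact n) \<le> 2 ^ (j + l + n)"
      by (rule norm_pochhammer_le)
    moreover have "norm (pochhammer (\<gamma>1 / 2) l / fact l) \<le> 2 ^ (i + l)"
      using ij by (intro norm_pochhammer_le)
    ultimately have "norm (ikml_gen_coeff w c \<gamma>1 \<gamma>2 l n) \<le>
        norm (-4 * w) ^ l * 2 ^ (i + l) * (norm c ^ n * 2 ^ (j + l + n))"
      unfolding ikml_gen_coeff_def norm_mult norm_power by (intro mult_mono) auto
    also have "\<dots> = 2 ^ (i + j) * (4 * norm w * 2 * 2) ^ l * (2 * norm c) ^ n"
      unfolding power_mult_distrib power_add norm_mult by simp
    finally show ?thesis by simp
  qed
  thus ?thesis by (intro that[of "2 ^ (i + j)"]) auto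
qed

section \<open>Termwise integration\<close>

lemma set_integral_sum:
  fixes f :: "'i \<Rightarrow> 'a \<Rightarrow> 'b :: {banach, second_countable_topology}"
  assumes "\<And>i. i \<in> I \<Longrightarrow> set_integrable M A (f i)"
  shows "(LINT x:A|M. \<Sum>i\<in>I. f i x) = (\<Sum>i\<in>I. LINT x:A|M. f i x)"
  using assms unfolding set_integrable_def set_lebesgue_integral_def scaleR_sum_right
  by (rule Bochner_Integration.integral_sum)

text \<open>
  A bound that separates the variables, an integrable function of \<open>x\<close> times a summable function of \<open>n\<close>,
  gives at once the two summability conditions of the theorem on termwise integration.
\<close>

lemma dominated_series_integral:
  fixes T :: "nat \<Rightarrow> 'a \<Rightarrow> 'b :: {banach, second_countable_topology}"
    and h :: "'a \<Rightarrow> real"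
  assumes h: "set_integrable M A h"
    and meas: "\<And>n. set_borel_measurable M A (T n)"
    and bound: "\<And>n x. x \<in> A \<Longrightarrow> norm (T n x) \<le> h x * m n"
    and m: "summable m"
  shows "set_integrable M A (\<lambda>x. \<Sum>n. T n x)"
    and "(\<lambda>n. LINT x:A|M. T n x) sums (LINT x:A|M. \<Sum>n. T n x)"
proof -
  define f where "f n x = indicator A x *\<^sub>R T n x" for n x
  have f_bound: "norm (f n x) \<le> indicator A x *\<^sub>R h x * m n" for n x
    using bound by (simp add: f_def indicator_def)
  have hm: "integrable M (\<lambda>x. indicator A x *\<^sub>R h x * m n)" for n
    using h unfolding set_integrable_def by (rule integrable_mult_left)
  have int: "integrable M (f n)" for n
  proof (rule Bochner_Integration.integrable_bound[OF hm[of n]])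
    show "f n \<in> borel_measurable M"
      using meas unfolding f_def set_borel_measurable_def by blast
    show "AE x in M. norm (f n x) \<le> norm (indicator A x *\<^sub>R h x * m n)"
      using f_bound by (intro AE_I2) (metis abs_ge_self order_trans real_norm_def)
  qed
  have AE: "AE x in M. summable (\<lambda>n. norm (f n x))"
  proof (rule AE_I2)
    fix x
    show "summable (\<lambda>n. norm (f n x))"
      by (rule summable_comparison_test'[OF summable_mult[OF m], of 0]) (use f_bound in simp)
  qed
  have sum: "summable (\<lambda>n. \<integral>x. norm (f n x) \<partial>M)"
  proof (rule summable_comparison_test'[where N = 0])
    show "summable (\<lambda>n. (\<integral>x. indicator A x *\<^sub>R h x \<partial>M) * m n)"
      using m by (rule summable_mult)
    fix n
    have "(\<integral>x. norm (f n x) \<partial>M) \<le> (\<integral>x. indicator A x *\<^sub>R h x * m n \<partial>M)"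
      by (intro integral_mono f_bound hm integrable_norm int)
    thus "norm (\<integral>x. norm (f n x) \<partial>M) \<le> (\<integral>x. indicator A x *\<^sub>R h x \<partial>M) * m n"
      by simp
  qed
  have "(\<lambda>x. \<Sum>n. f n x) = (\<lambda>x. indicator A x *\<^sub>R (\<Sum>n. T n x))"
    by (auto simp: f_def indicator_def)
  thus "set_integrable M A (\<lambda>x. \<Sum>n. T n x)"
    and "(\<lambda>n. LINT x:A|M. T n x) sums (LINT x:A|M. \<Sum>n. T n x)"
    using integrable_suminf[OF int AE sum] sums_integral[OF int AE sum]
    unfolding set_integrable_def set_lebesgue_integral_def by (simp_all add: f_def)
qed

section \<open>Convolution of series of Riemann-Liouville kernels\<close>

text \<open>
  Up to the factor $x^{p-1}$, a power series in $x^\omega$ with coefficients $\alpha_n / \Gamma(p+n\omega)$.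
\<close>

definition rl_series :: "complex \<Rightarrow> complex \<Rightarrow> (nat \<Rightarrow> complex) \<Rightarrow> real \<Rightarrow> complex" where
  "rl_series \<omega> p \<alpha> x = (\<Sum>n. \<alpha> n * rl_kernel (p + of_nat n * \<omega>) x)"

text \<open>
  A bound for the terms of an \<open>rl_series\<close> on $(0,z]$ after removing the factor $x^{\Re p-1}$, the only
  one that is singular at 0, for coefficients bounded by \<open>K * R ^ n\<close>.
\<close>

definition rl_majorant :: "complex \<Rightarrow> complex \<Rightarrow> real \<Rightarrow> real \<Rightarrow> real \<Rightarrow> nat \<Rightarrow> real" where
  "rl_majorant \<omega> p z K R n = K * ((R * z powr Re \<omega>) ^ n * norm (rGamma (p + of_nat n * \<omega>)))"

lemma rl_majorant_summable:
  assumes "Re \<omega> > 0" "R \<ge> 0"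
  shows "summable (rl_majorant \<omega> p z K R)"
  unfolding rl_majorant_def using assms by (intro summable_mult summable_power_rGamma) auto

lemma rl_majorant_nonneg: "K \<ge> 0 \<Longrightarrow> R \<ge> 0 \<Longrightarrow> rl_majorant \<omega> p z K R n \<ge> 0"
  by (simp add: rl_majorant_def)

lemma rl_series_measurable [measurable]: "rl_series \<omega> p \<alpha> \<in> borel_measurable borel"
  unfolding rl_series_def by measurable

lemma norm_rl_series_term_le:
  assumes "Re \<omega> > 0" "0 < x" "x \<le> z" and \<alpha>: "norm (\<alpha> n) \<le> K * R ^ n"
  shows "norm (\<alpha> n * rl_kernel (p + of_nat n * \<omega>) x) \<le> x powr (Re p - 1) * rl_majorant \<omega> p z K R n"
proof -
  have KR: "K * R ^ n \<ge> 0" using \<alpha> norm_ge_zero order_trans by blast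
  have "x powr (Re (p + of_nat n * \<omega>) - 1) = x powr (Re p - 1) * (x powr Re \<omega>) ^ n"
    using assms by (simp add: algebra_simps powr_powr flip: powr_add powr_realpow)
  also have "\<dots> \<le> x powr (Re p - 1) * (z powr Re \<omega>) ^ n"
    using assms by (intro mult_left_mono power_mono powr_mono2) auto
  finally have "norm (rl_kernel (p + of_nat n * \<omega>) x) \<le>
      x powr (Re p - 1) * (z powr Re \<omega>) ^ n * norm (rGamma (p + of_nat n * \<omega>))"
    using assms by (simp add: norm_rl_kernel mult_right_mono)
  from mult_mono[OF \<alpha> this KR] show ?thesis
    by (simp add: norm_mult rl_majorant_def power_mult_distrib mult_ac)
qed

lemma rl_series_bound:
  assumes "Re \<omega> > 0" "R \<ge> 0" "0 < x" "x \<le> z" and \<alpha>: "\<And>n. norm (\<alpha> n) \<le> K * R ^ n"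
  shows "summable (\<lambda>n. norm (\<alpha> n * rl_kernel (p + of_nat n * \<omega>) x))"
    and "norm (rl_series \<omega> p \<alpha> x) \<le> x powr (Re p - 1) * (\<Sum>n. rl_majorant \<omega> p z K R n)"
proof -
  have le: "norm (\<alpha> n * rl_kernel (p + of_nat n * \<omega>) x) \<le> x powr (Re p - 1) * rl_majorant \<omega> p z K R n" for n
    using assms by (intro norm_rl_series_term_le) auto
  have maj: "summable (rl_majorant \<omega> p z K R)"
    using assms by (intro rl_majorant_summable)
  show sum: "summable (\<lambda>n. norm (\<alpha> n * rl_kernel (p + of_nat n * \<omega>) x))"
    using le maj by (intro summable_comparison_test'[OF summable_mult[OF maj]]) auto
  have "norm (rl_series \<omega> p \<alpha> x) \<le> (\<Sum>n. norm (\<alpha> n * rl_kernel (p + of_nat n * \<omega>) x))"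
    unfolding rl_series_def by (rule summable_norm[OF sum])
  also have "\<dots> \<le> (\<Sum>n. x powr (Re p - 1) * rl_majorant \<omega> p z K R n)"
    by (intro suminf_le le sum summable_mult maj)
  finally show "norm (rl_series \<omega> p \<alpha> x) \<le> x powr (Re p - 1) * (\<Sum>n. rl_majorant \<omega> p z K R n)"
    using maj by (simp add: suminf_mult)
qed

text \<open>
  Multiply the two series as a Cauchy product and integrate termwise. In the \<open>n\<close>-th term all
  products have indices with sum \<open>n\<close>, so the semigroup law sends all of them to the same kernel.
\<close>

lemma rl_series_convolution:
  assumes re: "Re \<omega> > 0" "Re p > 0" "Re \<sigma> > 0" and z: "z > 0" and R: "R \<ge> 0"
    and \<alpha>: "\<And>n. norm (\<alpha> n) \<le> K * R ^ n" and \<beta>: "\<And>n. norm (\<beta> n) \<le> K' * R ^ n"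
  shows "set_integrable lborel {0<..<z} (\<lambda>x. rl_series \<omega> p \<alpha> (z - x) * rl_series \<omega> \<sigma> \<beta> x)"
    and "(\<lambda>n. (\<Sum>i\<le>n. \<alpha> i * \<beta> (n - i)) * rl_kernel (p + \<sigma> + of_nat n * \<omega>) z) sums
      (LBINT x:{0<..<z}. rl_series \<omega> p \<alpha> (z - x) * rl_series \<omega> \<sigma> \<beta> x)"
proof -
  define a where "a i x = \<alpha> i * rl_kernel (p + of_nat i * \<omega>) (z - x)" for i x
  define b where "b i x = \<beta> i * rl_kernel (\<sigma> + of_nat i * \<omega>) x" for i x
  define h where "h x = (z - x) powr (Re p - 1) * x powr (Re \<sigma> - 1)" for x
  define M where "M = rl_majorant \<omega> p z K R"
  define M' where "M' = rl_majorant \<omega> \<sigma> z K' R"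
  have K: "K \<ge> 0" "K' \<ge> 0" 
    using order_trans[OF norm_ge_zero \<alpha>[of 0]] order_trans[OF norm_ge_zero \<beta>[of 0]] by simp_all
  have M: "M n \<ge> 0" "M' n \<ge> 0" for n
    unfolding M_def M'_def using K R by (auto intro: rl_majorant_nonneg)
  have sumM: "summable (\<lambda>n. \<Sum>i\<le>n. M i * M' (n - i))"
    using rl_majorant_summable[OF re(1) R] M
    by (intro summable_Cauchy_product) (simp_all add: M_def M'_def)
  have product: "rl_series \<omega> p \<alpha> (z - x) * rl_series \<omega> \<sigma> \<beta> x = (\<Sum>n. \<Sum>i\<le>n. a i x * b (n - i) x)"
    if "x \<in> {0<..<z}" for x
    unfolding rl_series_def a_def b_def
    using that re R \<alpha> \<beta>
    by (intro Cauchy_product rl_series_bound(1)[where z = z and R = R]) auto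
  have bound: "norm (\<Sum>i\<le>n. a i x * b (n - i) x) \<le> h x * (\<Sum>i\<le>n. M i * M' (n - i))"
    if "x \<in> {0<..<z}" for n x
  proof -
    have "norm (a i x * b j x) \<le> h x * (M i * M' j)" for i j
    proof -
      have "norm (a i x) \<le> (z - x) powr (Re p - 1) * M i"
        unfolding a_def M_def using that re \<alpha> by (intro norm_rl_series_term_le) auto
      moreover have "norm (b j x) \<le> x powr (Re \<sigma> - 1) * M' j"
        unfolding b_def M'_def using that re \<beta> by (intro norm_rl_series_term_le) auto
      ultimately have "norm (a i x) * norm (b j x) \<le>
          ((z - x) powr (Re p - 1) * M i) * (x powr (Re \<sigma> - 1) * M' j)"
        using M by (intro mult_mono) auto
      thus ?thesis by (simp add: h_def norm_mult mult_ac)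
    qed
    thus ?thesis by (auto intro!: sum_norm_le simp: sum_distrib_left)
  qed
  have h: "set_integrable lborel {0<..<z} h"
    unfolding h_def using integrable_beta_weight[OF re(2,3) z] .
  have meas: "set_borel_measurable lborel {0<..<z} (\<lambda>x. \<Sum>i\<le>n. a i x * b (n - i) x)" for n
    unfolding set_borel_measurable_def a_def b_def by measurable
  note dom = dominated_series_integral[OF h meas bound sumM]
  have cong: "set_integrable lborel {0<..<z} (\<lambda>x. rl_series \<omega> p \<alpha> (z - x) * rl_series \<omega> \<sigma> \<beta> x) \<longleftrightarrow>
      set_integrable lborel {0<..<z} (\<lambda>x. \<Sum>n. \<Sum>i\<le>n. a i x * b (n - i) x)"
    by (intro set_integrable_cong product) auto
  show "set_integrable lborel {0<..<z} (\<lambda>x. rl_series \<omega> p \<alpha> (z - x) * rl_series \<omega> \<sigma> \<beta> x)"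
    unfolding cong by (rule dom(1))
  have "(LBINT x:{0<..<z}. \<Sum>i\<le>n. a i x * b (n - i) x) =
      (\<Sum>i\<le>n. \<alpha> i * \<beta> (n - i)) * rl_kernel (p + \<sigma> + of_nat n * \<omega>) z" for n
  proof -
    have pos: "Re (p + of_nat i * \<omega>) > 0" "Re (\<sigma> + of_nat i * \<omega>) > 0" for i
      using re by (auto intro: add_pos_nonneg)
    have ab: "a i x * b j x = (\<alpha> i * \<beta> j) *
        (rl_kernel (p + of_nat i * \<omega>) (z - x) * rl_kernel (\<sigma> + of_nat j * \<omega>) x)" for i j x
      by (simp add: a_def b_def)
    have "(LBINT x:{0<..<z}. \<Sum>i\<le>n. a i x * b (n - i) x) = (\<Sum>i\<le>n. LBINT x:{0<..<z}. a i x * b (n - i) x)"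
      unfolding ab
      by (intro set_integral_sum set_integrable_mult_right rl_kernel_convolution_integrable pos z)
    also have "\<dots> = (\<Sum>i\<le>n. (\<alpha> i * \<beta> (n - i)) * rl_kernel (p + \<sigma> + of_nat n * \<omega>) z)"
    proof (intro sum.cong refl)
      fix i assume "i \<in> {..n}"
      hence "p + of_nat i * \<omega> + (\<sigma> + of_nat (n - i) * \<omega>) = p + \<sigma> + of_nat n * \<omega>"
        by (simp add: of_nat_diff algebra_simps)
      thus "(LBINT x:{0<..<z}. a i x * b (n - i) x) =
          (\<alpha> i * \<beta> (n - i)) * rl_kernel (p + \<sigma> + of_nat n * \<omega>) z"
        unfolding ab set_integral_mult_right rl_kernel_convolution[OF pos z]
        by (rule arg_cong[where f = "\<lambda>a. _ * rl_kernel a z"])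
    qed
    finally show ?thesis by (simp add: sum_distrib_right)
  qed
  moreover have "(LBINT x:{0<..<z}. \<Sum>n. \<Sum>i\<le>n. a i x * b (n - i) x) =
      (LBINT x:{0<..<z}. rl_series \<omega> p \<alpha> (z - x) * rl_series \<omega> \<sigma> \<beta> x)"
    by (intro set_lebesgue_integral_cong) (auto simp: product)
  ultimately show "(\<lambda>n. (\<Sum>i\<le>n. \<alpha> i * \<beta> (n - i)) * rl_kernel (p + \<sigma> + of_nat n * \<omega>) z) sums
      (LBINT x:{0<..<z}. rl_series \<omega> p \<alpha> (z - x) * rl_series \<omega> \<sigma> \<beta> x)"
    using dom(2) by simp
qed

section \<open>The convolution formula for the Mittag-Leffler function\<close>

text \<open>
  After cancellation in the coefficient, each summand of \<open>ikml\<close>, multiplied by $x^{p-1} s^{q-1}$,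
  is a product of two kernels. The factor 1 on the right is the step \<open>\<omega>\<close> of the series over \<open>l\<close>.
\<close>

lemma ikml_summand:
  "ikml_coeff \<gamma>1 \<gamma>2 \<gamma>3 ((\<gamma>1 + 1) / 2) \<gamma>2 \<gamma>3 l n * (w * of_real x) ^ l *
      (c ^ n * of_real s powr (\<upsilon> * of_nat n)) /
      (Gamma (p + of_nat l) * Gamma (q + \<upsilon> * of_nat n) * fact n * fact l) *
      (of_real x powr (p - 1) * of_real s powr (q - 1)) =
    ikml_gen_coeff w c \<gamma>1 \<gamma>2 l n * rl_kernel (q + of_nat n * \<upsilon>) s * rl_kernel (p + of_nat l * 1) x"
  if "x > 0" "s > 0"
proof -
  have "p + of_nat l * 1 - 1 = (p - 1) + of_nat l"
    "q + of_nat n * \<upsilon> - 1 = (q - 1) + \<upsilon> * of_nat n"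
    by (simp_all add: algebra_simps)
  moreover have "complex_of_real x powr of_nat l = of_real x ^ l"
    using that by (intro powr_nat') auto
  ultimately have powr_eqs: "of_real x powr (p + of_nat l * 1 - 1) = of_real x powr (p - 1) * complex_of_real x ^ l"
    "of_real s powr (q + of_nat n * \<upsilon> - 1) = of_real s powr (q - 1) * complex_of_real s powr (\<upsilon> * of_nat n)"
    by (simp_all only: powr_add)
  have coeff: "ikml_coeff \<gamma>1 \<gamma>2 \<gamma>3 ((\<gamma>1 + 1) / 2) \<gamma>2 \<gamma>3 l n =
      (-4) ^ l * pochhammer (\<gamma>1 / 2) l * pochhammer (\<gamma>2 + of_nat l) n"
    by (simp add: ikml_coeff_def)
  show ?thesis
    unfolding ikml_gen_coeff_def rl_kernel_def coeff powr_eqs rGamma_inverse_Gamma power_mult_distrib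
    by (simp only: divide_inverse inverse_mult_distrib mult_ac mult_1)
qed

text \<open>
  The inner series, over \<open>n\<close>, are themselves exponentially bounded in \<open>l\<close>. Hence for fixed \<open>s\<close> they
  are admissible coefficients of an outer \<open>rl_series\<close>; that the bound depends on \<open>s\<close> only through
  $s^{\Re q-1}$ allows the later integration over \<open>s\<close>.
\<close>

lemma norm_rl_series_ikml_gen_coeff_le:
  assumes "Re \<upsilon> > 0" "0 < s" "s \<le> t"
    and num: "\<And>l n. norm (ikml_gen_coeff w c \<gamma>1 \<gamma>2 l n) \<le> K * (16 * norm w) ^ l * (2 * norm c) ^ n"
  shows "norm (rl_series \<upsilon> q (ikml_gen_coeff w c \<gamma>1 \<gamma>2 l) s) \<le>
      s powr (Re q - 1) * suminf (rl_majorant \<upsilon> q t K (2 * norm c)) * (16 * norm w) ^ l"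
proof -
  have "norm (rl_series \<upsilon> q (ikml_gen_coeff w c \<gamma>1 \<gamma>2 l) s) \<le>
      s powr (Re q - 1) * (\<Sum>n. rl_majorant \<upsilon> q t (K * (16 * norm w) ^ l) (2 * norm c) n)"
    by (rule rl_series_bound(2)[OF assms(1) _ assms(2,3) num]) simp
  also have "(\<Sum>n. rl_majorant \<upsilon> q t (K * (16 * norm w) ^ l) (2 * norm c) n) =
      (\<Sum>n. (16 * norm w) ^ l * rl_majorant \<upsilon> q t K (2 * norm c) n)"
    unfolding rl_majorant_def by (simp only: mult_ac)
  also have "\<dots> = (16 * norm w) ^ l * suminf (rl_majorant \<upsilon> q t K (2 * norm c))"
    using assms by (intro suminf_mult rl_majorant_summable) auto
  finally show ?thesis by (simp add: mult_ac)
qed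

text \<open>
  This separates the two variables: for fixed \<open>s\<close> it is a one-variable series with step \<open>1\<close>, and its
  coefficients are one-variable series with step \<open>\<upsilon>\<close>, so the one-dimensional convolution theorem
  applies to each variable in turn.
\<close>

lemma ikml_eq_rl_series:
  assumes "Re \<upsilon> > 0" "x > 0" "s > 0"
  shows "of_real x powr (p - 1) * of_real s powr (q - 1) *
      ikml \<gamma>1 \<gamma>2 \<gamma>3 ((\<gamma>1 + 1) / 2) \<gamma>2 \<gamma>3 p q \<upsilon> (w * of_real x) c s =
    rl_series 1 p (\<lambda>l. rl_series \<upsilon> q (ikml_gen_coeff w c \<gamma>1 \<gamma>2 l) s) x"
proof -
  obtain K where K: "\<And>l n. norm (ikml_gen_coeff w c \<gamma>1 \<gamma>2 l n) \<le> K * (16 * norm w) ^ l * (2 * norm c) ^ n"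
    using ikml_gen_coeff_bound by metis
  define X where "X = of_real x powr (p - 1) * complex_of_real s powr (q - 1)"
  have X: "X \<noteq> 0" using assms by (simp add: X_def)
  let ?a = "\<lambda>l n. ikml_gen_coeff w c \<gamma>1 \<gamma>2 l n * rl_kernel (q + of_nat n * \<upsilon>) s * rl_kernel (p + of_nat l * 1) x"
  have "ikml \<gamma>1 \<gamma>2 \<gamma>3 ((\<gamma>1 + 1) / 2) \<gamma>2 \<gamma>3 p q \<upsilon> (w * of_real x) c s = (\<Sum>l. \<Sum>n. ?a l n / X)"
    unfolding ikml_def
    by (intro suminf_cong iffD2[OF nonzero_eq_divide_eq[OF X]])
       (unfold X_def, rule ikml_summand[OF assms(2,3)])
  also have "\<dots> = (\<Sum>l. rl_series \<upsilon> q (ikml_gen_coeff w c \<gamma>1 \<gamma>2 l) s * rl_kernel (p + of_nat l * 1) x / X)"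
  proof (rule arg_cong[of _ _ suminf], rule ext)
    fix l
    have "summable (\<lambda>n. ikml_gen_coeff w c \<gamma>1 \<gamma>2 l n * rl_kernel (q + of_nat n * \<upsilon>) s)"
      by (rule summable_norm_cancel, rule rl_series_bound(1)[OF assms(1) _ assms(3) order_refl K]) simp
    from suminf_mult2[OF this, of "rl_kernel (p + of_nat l * 1) x / X"]
    show "(\<Sum>n. ?a l n / X) = rl_series \<upsilon> q (ikml_gen_coeff w c \<gamma>1 \<gamma>2 l) s * rl_kernel (p + of_nat l * 1) x / X"
      unfolding rl_series_def by simp
  qed
  also have "\<dots> = rl_series 1 p (\<lambda>l. rl_series \<upsilon> q (ikml_gen_coeff w c \<gamma>1 \<gamma>2 l) s) x / X"
    unfolding rl_series_def[of 1]
  proof (intro suminf_divide, rule summable_norm_cancel)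
    have bound: "norm (rl_series \<upsilon> q (ikml_gen_coeff w c \<gamma>1 \<gamma>2 l) s) \<le>
        s powr (Re q - 1) * suminf (rl_majorant \<upsilon> q s K (2 * norm c)) * (16 * norm w) ^ l" for l
      by (rule norm_rl_series_ikml_gen_coeff_le[OF assms(1) assms(3) order_refl K])
    show "summable (\<lambda>l. norm (rl_series \<upsilon> q (ikml_gen_coeff w c \<gamma>1 \<gamma>2 l) s * rl_kernel (p + of_nat l * 1) x))"
      by (rule rl_series_bound(1)[OF _ _ assms(2) order_refl bound]) simp_all
  qed
  finally show ?thesis using X by (simp add: X_def)
qed

theorem theorem58:
  fixes p q \<upsilon> \<sigma> \<tau> w1 w2 \<gamma>1 \<gamma>2 \<gamma>3 \<mu>1 \<mu>2 \<mu>3 c :: complex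
    and z t :: real
    and F :: "real \<Rightarrow> real \<Rightarrow> complex"
  assumes "Re p > 0" "Re q > 0" "Re \<upsilon> > 0" "Re \<sigma> > 0" "Re \<tau> > 0"
    and "is_power_value w2 \<upsilon> c"
    and "z > 0" "t > 0"
  defines "F \<equiv> \<lambda>\<xi> y.
      of_real (z - \<xi>) powr (p - 1) * of_real (t - y) powr (q - 1) *
      ikml \<gamma>1 \<gamma>2 \<gamma>3 ((\<gamma>1 + 1) / 2) \<gamma>2 \<gamma>3 p q \<upsilon> (w1 * of_real (z - \<xi>)) c (t - y) *
      (of_real \<xi> powr (\<sigma> - 1) * of_real y powr (\<tau> - 1) *
       ikml \<mu>1 \<mu>2 \<mu>3 ((\<mu>1 + 1) / 2) \<mu>2 \<mu>3 \<sigma> \<tau> \<upsilon> (w1 * of_real \<xi>) c y)"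
  shows "(\<forall>y\<in>{0<..<t}. set_integrable lborel {0<..<z} (\<lambda>\<xi>. F \<xi> y)) \<and>
    set_integrable lborel {0<..<t} (\<lambda>y. LBINT \<xi>:{0<..<z}. F \<xi> y) \<and>
    (LBINT y:{0<..<t}. LBINT \<xi>:{0<..<z}. F \<xi> y) =
      of_real z powr (p + \<sigma> - 1) * of_real t powr (q + \<tau> - 1) *
      ikml (\<gamma>1 + \<mu>1) (\<gamma>2 + \<mu>2) (\<gamma>3 + \<mu>3) ((\<gamma>1 + \<mu>1 + 1) / 2) (\<gamma>2 + \<mu>2) (\<gamma>3 + \<mu>3)
        (p + \<sigma>) (q + \<tau>) \<upsilon> (w1 * of_real z) c t"
proof -
  note re = assms(1-5) and z = \<open>z > 0\<close> and t = \<open>t > 0\<close>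
  define A where "A l = rl_series \<upsilon> q (ikml_gen_coeff w1 c \<gamma>1 \<gamma>2 l)" for l
  define B where "B l = rl_series \<upsilon> \<tau> (ikml_gen_coeff w1 c \<mu>1 \<mu>2 l)" for l
  define R where "R = 16 * norm w1"
  have R: "R \<ge> 0" by (simp add: R_def)
  have A_meas [measurable]: "A l \<in> borel_measurable borel" for l
    unfolding A_def by measurable
  have B_meas [measurable]: "B l \<in> borel_measurable borel" for l
    unfolding B_def by measurable
  obtain K where K: "K \<ge> 0"
    "\<And>l n. norm (ikml_gen_coeff w1 c \<gamma>1 \<gamma>2 l n) \<le> K * (16 * norm w1) ^ l * (2 * norm c) ^ n"
    using ikml_gen_coeff_bound by metis
  obtain K' where K': "K' \<ge> 0"
    "\<And>l n. norm (ikml_gen_coeff w1 c \<mu>1 \<mu>2 l n) \<le> K' * (16 * norm w1) ^ l * (2 * norm c) ^ n"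
    using ikml_gen_coeff_bound by metis
  define M where "M = suminf (rl_majorant \<upsilon> q t K (2 * norm c))"
  define M' where "M' = suminf (rl_majorant \<upsilon> \<tau> t K' (2 * norm c))"
  have A_le: "norm (A l s) \<le> s powr (Re q - 1) * M * R ^ l" if "0 < s" "s \<le> t" for l s
    unfolding A_def M_def R_def using re that K by (intro norm_rl_series_ikml_gen_coeff_le)
  have B_le: "norm (B l s) \<le> s powr (Re \<tau> - 1) * M' * R ^ l" if "0 < s" "s \<le> t" for l s
    unfolding B_def M'_def R_def using re that K' by (intro norm_rl_series_ikml_gen_coeff_le)
  have M: "M \<ge> 0" "M' \<ge> 0"
    unfolding M_def M'_def using re K(1) K'(1)
    by (auto intro!: suminf_nonneg rl_majorant_summable rl_majorant_nonneg)

  have F_eq: "F \<xi> y = rl_series 1 p (\<lambda>l. A l (t - y)) (z - \<xi>) * rl_series 1 \<sigma> (\<lambda>l. B l y) \<xi>"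
    if "\<xi> \<in> {0<..<z}" "y \<in> {0<..<t}" for \<xi> y
    unfolding F_def A_def B_def using that re by (simp only: ikml_eq_rl_series greaterThanLessThan_iff diff_gt_0_iff_gt)

  have inner: "set_integrable lborel {0<..<z} (\<lambda>\<xi>. F \<xi> y)"
      "(LBINT \<xi>:{0<..<z}. F \<xi> y) =
        (\<Sum>L. (\<Sum>l\<le>L. A l (t - y) * B (L - l) y) * rl_kernel (p + \<sigma> + of_nat L * 1) z)"
    if y: "y \<in> {0<..<t}" for y
  proof -
    have bounds: "norm (A l (t - y)) \<le> ((t - y) powr (Re q - 1) * M) * R ^ l"
        "norm (B l y) \<le> (y powr (Re \<tau> - 1) * M') * R ^ l" for l
      using A_le[of "t - y" l] B_le[of y l] y by auto
    have conv: "set_integrable lborel {0<..<z}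
        (\<lambda>\<xi>. rl_series 1 p (\<lambda>l. A l (t - y)) (z - \<xi>) * rl_series 1 \<sigma> (\<lambda>l. B l y) \<xi>)"
      "(\<lambda>L. (\<Sum>l\<le>L. A l (t - y) * B (L - l) y) * rl_kernel (p + \<sigma> + of_nat L * 1) z) sums
        (LBINT \<xi>:{0<..<z}. rl_series 1 p (\<lambda>l. A l (t - y)) (z - \<xi>) * rl_series 1 \<sigma> (\<lambda>l. B l y) \<xi>)"
      using rl_series_convolution[OF _ re(1) re(4) z R bounds, of 1] by simp_all
    have "set_integrable lborel {0<..<z} (\<lambda>\<xi>. F \<xi> y) \<longleftrightarrow> set_integrable lborel {0<..<z}
        (\<lambda>\<xi>. rl_series 1 p (\<lambda>l. A l (t - y)) (z - \<xi>) * rl_series 1 \<sigma> (\<lambda>l. B l y) \<xi>)"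
      using y by (intro set_integrable_cong F_eq) auto
    thus "set_integrable lborel {0<..<z} (\<lambda>\<xi>. F \<xi> y)" using conv(1) by simp
    have "(LBINT \<xi>:{0<..<z}. F \<xi> y) =
        (LBINT \<xi>:{0<..<z}. rl_series 1 p (\<lambda>l. A l (t - y)) (z - \<xi>) * rl_series 1 \<sigma> (\<lambda>l. B l y) \<xi>)"
      using y by (intro set_lebesgue_integral_cong) (auto simp: F_eq)
    thus "(LBINT \<xi>:{0<..<z}. F \<xi> y) =
        (\<Sum>L. (\<Sum>l\<le>L. A l (t - y) * B (L - l) y) * rl_kernel (p + \<sigma> + of_nat L * 1) z)"
      using sums_unique[OF conv(2)] by simp
  qed

  \<comment> \<open>The outer integral is taken term by term in the series found for the inner one. The extra factor
    2 in m absorbs the number \<open>L + 1\<close> of products in the L-th term.\<close>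
  define T where "T L y = (\<Sum>l\<le>L. A l (t - y) * B (L - l) y) * rl_kernel (p + \<sigma> + of_nat L * 1) z" for L y
  define h where "h y = (t - y) powr (Re q - 1) * y powr (Re \<tau> - 1)" for y
  define m where "m L = z powr (Re (p + \<sigma>) - 1) * rl_majorant 1 (p + \<sigma>) z (M * M') (2 * R) L" for L
  have h: "set_integrable lborel {0<..<t} h"
    unfolding h_def using integrable_beta_weight[OF re(2) re(5) t] .
  have m: "summable m"
    unfolding m_def using R by (intro summable_mult rl_majorant_summable) auto
  have T_meas: "set_borel_measurable lborel {0<..<t} (T L)" for L
    unfolding set_borel_measurable_def T_def by measurable
  have T_bound: "norm (T L y) \<le> h y * m L" if y: "y \<in> {0<..<t}" for L y
  proof -
    have "norm (A l (t - y) * B (L - l) y) \<le> h y * (M * M') * R ^ L" if "l \<le> L" for l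
    proof -
      have "norm (A l (t - y)) * norm (B (L - l) y) \<le>
          ((t - y) powr (Re q - 1) * M * R ^ l) * (y powr (Re \<tau> - 1) * M' * R ^ (L - l))"
        using A_le[of "t - y" l] B_le[of y "L - l"] y M R by (intro mult_mono) auto
      also have "\<dots> = h y * (M * M') * (R ^ l * R ^ (L - l))"
        by (simp add: h_def mult_ac)
      finally show ?thesis using that by (simp add: norm_mult flip: power_add)
    qed
    hence "norm (\<Sum>l\<le>L. A l (t - y) * B (L - l) y) \<le> (\<Sum>l\<le>L. h y * (M * M') * R ^ L)"
      by (intro sum_norm_le) auto
    also have "\<dots> = real (L + 1) * (h y * (M * M') * R ^ L)" by simp
    also have "\<dots> \<le> 2 ^ L * (h y * (M * M') * R ^ L)"
    proof (rule mult_right_mono)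
      have "L + 1 \<le> 2 ^ L" by (induction L) auto
      thus "real (L + 1) \<le> 2 ^ L" by (metis of_nat_le_iff of_nat_numeral of_nat_power)
    qed (use M R in \<open>simp add: h_def\<close>)
    finally have "norm (\<Sum>l\<le>L. A l (t - y) * B (L - l) y) \<le> (h y * (M * M')) * (2 * R) ^ L"
      by (simp add: power_mult_distrib mult_ac)
    from norm_rl_series_term_le[of 1 z z "\<lambda>_. \<Sum>l\<le>L. A l (t - y) * B (L - l) y", OF _ z order_refl this,
        where p = "p + \<sigma>"]
    show ?thesis by (simp add: T_def m_def rl_majorant_def mult_ac)
  qed
  note dom = dominated_series_integral[OF h T_meas T_bound m]

  have T_integral: "(LBINT y:{0<..<t}. T L y) =
      rl_series \<upsilon> (q + \<tau>) (ikml_gen_coeff w1 c (\<gamma>1 + \<mu>1) (\<gamma>2 + \<mu>2) L) t * rl_kernel (p + \<sigma> + of_nat L * 1) z" for L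
  proof -
    have c2: "2 * norm c \<ge> 0" by simp
    \<comment> \<open>Each product contributes a series in which N is the total second index; adding these for
      all l brings in the two-dimensional Cauchy product of the coefficients.\<close>
    note conv = rl_series_convolution[OF re(3) re(2) re(5) t c2 K(2) K'(2), folded A_def B_def]
    have "(LBINT y:{0<..<t}. T L y) =
        (LBINT y:{0<..<t}. \<Sum>l\<le>L. A l (t - y) * B (L - l) y) * rl_kernel (p + \<sigma> + of_nat L * 1) z"
      unfolding T_def by (rule set_integral_mult_left)
    also have "(LBINT y:{0<..<t}. \<Sum>l\<le>L. A l (t - y) * B (L - l) y) =
        (\<Sum>l\<le>L. LBINT y:{0<..<t}. A l (t - y) * B (L - l) y)"
      by (intro set_integral_sum conv(1))
    also have "\<dots> = (\<Sum>N. \<Sum>l\<le>L. (\<Sum>n\<le>N. ikml_gen_coeff w1 c \<gamma>1 \<gamma>2 l n * ikml_gen_coeff w1 c \<mu>1 \<mu>2 (L - l) (N - n)) *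
        rl_kernel (q + \<tau> + of_nat N * \<upsilon>) t)"
      by (intro sums_unique sums_sum conv(2))
    also have "\<dots> = rl_series \<upsilon> (q + \<tau>) (ikml_gen_coeff w1 c (\<gamma>1 + \<mu>1) (\<gamma>2 + \<mu>2) L) t"
      unfolding rl_series_def sum_distrib_right[symmetric] ikml_gen_coeff_Cauchy_product ..
    finally show ?thesis .
  qed

  have outer: "set_integrable lborel {0<..<t} (\<lambda>y. LBINT \<xi>:{0<..<z}. F \<xi> y)"
  proof -
    have "set_integrable lborel {0<..<t} (\<lambda>y. LBINT \<xi>:{0<..<z}. F \<xi> y) \<longleftrightarrow>
        set_integrable lborel {0<..<t} (\<lambda>y. \<Sum>L. T L y)"
      by (intro set_integrable_cong) (auto simp: inner(2) T_def)
    thus ?thesis using dom(1) by simp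
  qed
  have "(LBINT y:{0<..<t}. LBINT \<xi>:{0<..<z}. F \<xi> y) = (LBINT y:{0<..<t}. \<Sum>L. T L y)"
    by (intro set_lebesgue_integral_cong) (auto simp: inner(2) T_def)
  also have "\<dots> = (\<Sum>L. LBINT y:{0<..<t}. T L y)"
    by (rule sums_unique[OF dom(2)])
  also have "\<dots> = rl_series 1 (p + \<sigma>)
      (\<lambda>L. rl_series \<upsilon> (q + \<tau>) (ikml_gen_coeff w1 c (\<gamma>1 + \<mu>1) (\<gamma>2 + \<mu>2) L) t) z"
    unfolding T_integral rl_series_def[of 1] ..
  also have "\<dots> = of_real z powr (p + \<sigma> - 1) * of_real t powr (q + \<tau> - 1) *
      ikml (\<gamma>1 + \<mu>1) (\<gamma>2 + \<mu>2) (\<gamma>3 + \<mu>3) ((\<gamma>1 + \<mu>1 + 1) / 2) (\<gamma>2 + \<mu>2) (\<gamma>3 + \<mu>3)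
        (p + \<sigma>) (q + \<tau>) \<upsilon> (w1 * of_real z) c t"
    using ikml_eq_rl_series[OF re(3) z t] by simp
  finally show ?thesis using inner(1) outer by blast
qed

end
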